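(* For odd $n\geq 3$, let $\mathrm{Dic}_n=\langle a,b,c\mid a^n=b^2=c^2=abc\rangle$ be the dicyclic group of order $4n$. Then Player 2 has a winning strategy for $\texttt{REL}(\mathrm{Dic}_n,\{a,b,c\})$.
   Context: Game $\texttt{REL}(G,S)$: $G$ is a finite group and $S$ a generating set with $e\notin S$. Two players alternate turns, Player 1 first, starting from the empty word $w_0$. On turn $n$ the current player chooses $s_n\in S\cup S^{-1}$, subject to $s_n\neq s_{n-1}^{-1}$ when $n>1$, and forms $w_n=w_{n-1}s_n$. If $w_n$ represents the same element of $G$ as some $w_k$ with $0\le k<n$, the player who formed $w_n$ wins. If a player has no legal move, that player loses. *)

theory Defs
  imports "HOL-Algebra.Generated_Groups"
begin

section \<open>Groups given by generators and relations\<close>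

text \<open>
  A word over the generators \<open>'g\<close> is a list of letters; \<open>(x, True)\<close> stands for \<open>x\<close> and
  \<open>(x, False)\<close> for its formal inverse. A relation \<open>l = r\<close> is the pair \<open>(l, r)\<close>.
\<close>

type_synonym 'g gword = "('g \<times> bool) list"

inductive pres_eq :: "('g gword \<times> 'g gword) set \<Rightarrow> 'g gword \<Rightarrow> 'g gword \<Rightarrow> bool"
  for R where
  refl: "pres_eq R u u"
| sym: "pres_eq R u v \<Longrightarrow> pres_eq R v u"
| trans: "pres_eq R u v \<Longrightarrow> pres_eq R v w \<Longrightarrow> pres_eq R u w"
| cancel: "pres_eq R (u @ [(x, e), (x, \<not> e)] @ v) (u @ v)"
| relation: "(l, r) \<in> R \<Longrightarrow> pres_eq R (u @ l @ v) (u @ r @ v)"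

definition pres_class :: "('g gword \<times> 'g gword) set \<Rightarrow> 'g gword \<Rightarrow> 'g gword set" where
  "pres_class R u = {v. pres_eq R u v}"

definition presented_group :: "('g gword \<times> 'g gword) set \<Rightarrow> 'g gword set monoid" where
  "presented_group R =
    \<lparr>carrier = range (pres_class R),
     mult = (\<lambda>U V. {w. \<exists>u\<in>U. \<exists>v\<in>V. pres_eq R (u @ v) w}),
     one = pres_class R []\<rparr>"

definition pres_gen :: "('g gword \<times> 'g gword) set \<Rightarrow> 'g \<Rightarrow> 'g gword set" where
  "pres_gen R x = pres_class R [(x, True)]"

lemma pres_eq_append:
  assumes "pres_eq R u u'" "pres_eq R v v'"
  shows "pres_eq R (u @ v) (u' @ v')"
proof -
  have 1: "pres_eq R (p @ x @ q) (p @ y @ q)" if "pres_eq R x y" for x y p q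
    using that
  proof induction
    case (cancel u x e v)
    show ?case using pres_eq.cancel[of R "p @ u" x e "v @ q"] by simp
  next
    case (relation l r u v)
    then show ?case using pres_eq.relation[of l r R "p @ u" "v @ q"] by simp
  qed (auto intro: pres_eq.intros)
  from 1[OF assms(1), of "[]" v] 1[OF assms(2), of u' "[]"]
  show ?thesis by (auto intro: pres_eq.trans)
qed

lemma pres_class_eq_iff: "pres_class R u = pres_class R v \<longleftrightarrow> pres_eq R u v"
  unfolding pres_class_def by (auto intro: pres_eq.intros)

lemma pres_mult: "pres_class R u \<otimes>\<^bsub>presented_group R\<^esub> pres_class R v = pres_class R (u @ v)"
  unfolding presented_group_def pres_class_def
  by (auto intro: pres_eq.refl) (meson pres_eq_append pres_eq.trans)

lemma pres_carrier: "carrier (presented_group R) = range (pres_class R)"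
  and pres_one: "\<one>\<^bsub>presented_group R\<^esub> = pres_class R []"
  by (simp_all add: presented_group_def)

definition inv_word :: "'g gword \<Rightarrow> 'g gword" where
  "inv_word u = rev (map (\<lambda>(x, e). (x, \<not> e)) u)"

lemma pres_eq_inv_word: "pres_eq R (inv_word u @ u) []"
proof (induction u)
  case Nil
  show ?case by (simp add: inv_word_def pres_eq.refl)
next
  case (Cons l u)
  obtain x e where l: "l = (x, e)" by force
  have "inv_word (l # u) @ l # u = inv_word u @ [(x, \<not> e), (x, \<not> \<not> e)] @ u"
    by (simp add: inv_word_def l)
  then show ?case using Cons pres_eq.cancel[of R "inv_word u" x "\<not> e" u]
    by (metis pres_eq.trans)
qed

lemma group_presented_group: "group (presented_group R)"
proof (rule groupI)
  fix X assume "X \<in> carrier (presented_group R)"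
  then obtain u where u: "X = pres_class R u" by (auto simp: pres_carrier)
  have "pres_class R (inv_word u) \<otimes>\<^bsub>presented_group R\<^esub> X = \<one>\<^bsub>presented_group R\<^esub>"
    unfolding u pres_mult pres_one pres_class_eq_iff by (rule pres_eq_inv_word)
  then show "\<exists>Y\<in>carrier (presented_group R). Y \<otimes>\<^bsub>presented_group R\<^esub> X = \<one>\<^bsub>presented_group R\<^esub>"
    by (auto simp: pres_carrier)
qed (auto simp: pres_carrier pres_mult pres_one)

lemma pres_class_snoc_True:
  "pres_class R (u @ [(x, True)]) = pres_class R u \<otimes>\<^bsub>presented_group R\<^esub> pres_gen R x"
  by (simp add: pres_mult pres_gen_def)

lemma pres_gen_carrier: "pres_gen R x \<in> carrier (presented_group R)"
  by (simp add: pres_carrier pres_gen_def)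

lemma pres_class_inv_letter:
  "pres_class R [(x, False)] = inv\<^bsub>presented_group R\<^esub> (pres_gen R x)"
proof -
  interpret group "presented_group R" by (rule group_presented_group)
  have "pres_class R [(x, False)] \<otimes>\<^bsub>presented_group R\<^esub> pres_gen R x = \<one>\<^bsub>presented_group R\<^esub>"
    using pres_eq_inv_word[of R "[(x, True)]"]
    by (simp add: pres_mult pres_gen_def pres_one pres_class_eq_iff inv_word_def)
  then show ?thesis
    using inv_equality[of "pres_class R [(x, False)]" "pres_gen R x"]
    by (metis pres_gen_carrier pres_carrier rangeI)
qed

lemma pres_class_snoc_False:
  "pres_class R (u @ [(x, False)]) =
    pres_class R u \<otimes>\<^bsub>presented_group R\<^esub> inv\<^bsub>presented_group R\<^esub> (pres_gen R x)"
  by (simp add: pres_mult flip: pres_class_inv_letter)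

lemma pres_generate:
  "generate (presented_group R) (range (pres_gen R)) = carrier (presented_group R)"
proof -
  interpret group "presented_group R" by (rule group_presented_group)
  have "pres_class R u \<in> generate (presented_group R) (range (pres_gen R))" for u
  proof (induction u rule: rev_induct)
    case Nil
    show ?case using generate.one by (simp flip: pres_one)
  next
    case (snoc l u)
    obtain x e where l: "l = (x, e)" by force
    show ?case using snoc unfolding l
      by (cases e) (auto simp: pres_class_snoc_True pres_class_snoc_False
          intro: generate.eng generate.incl generate.inv)
  qed
  moreover have "generate (presented_group R) (range (pres_gen R)) \<subseteq> carrier (presented_group R)"
    by (rule generate_incl) (auto simp: pres_gen_carrier)
  ultimately show ?thesis by (auto simp: pres_carrier)
qed

definition word_val :: "('h, 'b) monoid_scheme \<Rightarrow> ('g \<Rightarrow> 'h) \<Rightarrow> 'g gword \<Rightarrow> 'h" where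
  "word_val H f u =
    foldr (\<lambda>(x, e) y. (if e then f x else inv\<^bsub>H\<^esub> (f x)) \<otimes>\<^bsub>H\<^esub> y) u \<one>\<^bsub>H\<^esub>"

text \<open>The universal property of the presentation.\<close>

lemma presented_group_hom:
  assumes H: "group H" and f: "\<And>x. f x \<in> carrier H"
    and rels: "\<And>l r. (l, r) \<in> R \<Longrightarrow> word_val H f l = word_val H f r"
  shows "\<exists>h \<in> hom (presented_group R) H. \<forall>x. h (pres_gen R x) = f x"
proof -
  interpret H: group H by fact
  have cl[simp]: "word_val H f u \<in> carrier H" for u
    by (induction u) (auto simp: word_val_def f)
  have app: "word_val H f (u @ v) = word_val H f u \<otimes>\<^bsub>H\<^esub> word_val H f v" for u v
  proof (induction u)
    case Nil
    show ?case using cl[of v] by (simp add: word_val_def)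
  next
    case (Cons l u)
    have "word_val H f (l # w) = word_val H f [l] \<otimes>\<^bsub>H\<^esub> word_val H f w" for w
      using cl[of w] by (cases l) (auto simp: word_val_def f)
    then show ?case using Cons by (metis H.m_assoc append_Cons cl)
  qed
  have eq: "word_val H f u = word_val H f v" if "pres_eq R u v" for u v
    using that
  proof induction
    case (cancel u x e v)
    have "word_val H f [(x, e), (x, \<not> e)] = \<one>\<^bsub>H\<^esub>"
      by (simp add: word_val_def f)
    then show ?case by (simp only: app H.l_one cl)
  next
    case (relation l r u v)
    then show ?case by (simp add: app rels)
  qed auto
  define h where "h X = word_val H f (SOME u. u \<in> X)" for X
  have h: "h (pres_class R u) = word_val H f u" for u
  proof -
    have "u \<in> pres_class R u" by (simp add: pres_class_def pres_eq.refl)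
    then have "(SOME v. v \<in> pres_class R u) \<in> pres_class R u" by (rule someI)
    then show ?thesis unfolding h_def pres_class_def by (auto dest: eq)
  qed
  have "h \<in> hom (presented_group R) H"
    by (auto simp: hom_def pres_carrier h pres_mult app)
  moreover have "h (pres_gen R x) = f x" for x
    by (simp add: pres_gen_def h word_val_def f)
  ultimately show ?thesis by blast
qed

section \<open>The dicyclic groups\<close>

datatype dic_gen = GenA | GenB | GenC

text \<open>The chain \<open>a^n = b^2 = c^2 = abc\<close>.\<close>

definition dic_rels :: "nat \<Rightarrow> (dic_gen gword \<times> dic_gen gword) set" where
  "dic_rels n =
    {(replicate n (GenA, True), replicate 2 (GenB, True)),
     (replicate 2 (GenB, True), replicate 2 (GenC, True)),
     (replicate 2 (GenC, True), [(GenA, True), (GenB, True), (GenC, True)])}"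

definition Dic :: "nat \<Rightarrow> dic_gen gword set monoid" where
  "Dic n = presented_group (dic_rels n)"

definition dic_a :: "nat \<Rightarrow> dic_gen gword set" where "dic_a n = pres_gen (dic_rels n) GenA"
definition dic_b :: "nat \<Rightarrow> dic_gen gword set" where "dic_b n = pres_gen (dic_rels n) GenB"
definition dic_c :: "nat \<Rightarrow> dic_gen gword set" where "dic_c n = pres_gen (dic_rels n) GenC"


lemma dic_relations:
  fixes n :: nat
  defines "G \<equiv> Dic n"
  shows "dic_a n [^]\<^bsub>G\<^esub> n = dic_b n \<otimes>\<^bsub>G\<^esub> dic_b n"
    and "dic_b n \<otimes>\<^bsub>G\<^esub> dic_b n = dic_c n \<otimes>\<^bsub>G\<^esub> dic_c n"
    and "dic_c n \<otimes>\<^bsub>G\<^esub> dic_c n = dic_a n \<otimes>\<^bsub>G\<^esub> dic_b n \<otimes>\<^bsub>G\<^esub> dic_c n"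
proof -
  have pw: "pres_gen R x [^]\<^bsub>presented_group R\<^esub> k = pres_class R (replicate k (x, True))"
    for R and x :: 'g and k :: nat
  proof (induction k)
    case 0
    show ?case by (simp add: pres_one)
  next
    case (Suc k)
    have "pres_class R (replicate (Suc k) (x, True)) = pres_class R (replicate k (x, True) @ [(x, True)])"
      by (simp add: replicate_append_same)
    then show ?case using Suc by (simp add: pres_class_snoc_True)
  qed
  have rel: "pres_class R l = pres_class R r" if "(l, r) \<in> R"
    for R and l r :: "'g gword"
    using pres_eq.relation[OF that, of "[]" "[]"] by (simp add: pres_class_eq_iff)
  show "dic_a n [^]\<^bsub>G\<^esub> n = dic_b n \<otimes>\<^bsub>G\<^esub> dic_b n"
    unfolding G_def Dic_def dic_a_def dic_b_def pw
    using rel[of "replicate n (GenA, True)" "replicate 2 (GenB, True)" "dic_rels n"]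
    by (simp add: dic_rels_def pres_gen_def pres_mult numeral_2_eq_2)
  show "dic_b n \<otimes>\<^bsub>G\<^esub> dic_b n = dic_c n \<otimes>\<^bsub>G\<^esub> dic_c n"
    unfolding G_def Dic_def dic_b_def dic_c_def
    using rel[of "replicate 2 (GenB, True)" "replicate 2 (GenC, True)" "dic_rels n"]
    by (simp add: dic_rels_def pres_gen_def pres_mult numeral_2_eq_2)
  show "dic_c n \<otimes>\<^bsub>G\<^esub> dic_c n = dic_a n \<otimes>\<^bsub>G\<^esub> dic_b n \<otimes>\<^bsub>G\<^esub> dic_c n"
    unfolding G_def Dic_def dic_a_def dic_b_def dic_c_def
    using rel[of "replicate 2 (GenC, True)" "[(GenA, True), (GenB, True), (GenC, True)]" "dic_rels n"]
    by (simp add: dic_rels_def pres_gen_def pres_mult numeral_2_eq_2)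
qed

lemma dic_carrier [simp]:
  "dic_a n \<in> carrier (Dic n)" "dic_b n \<in> carrier (Dic n)" "dic_c n \<in> carrier (Dic n)"
  by (simp_all add: Dic_def dic_a_def dic_b_def dic_c_def pres_gen_carrier)

lemma group_Dic: "group (Dic n)"
  by (simp add: Dic_def group_presented_group)

lemma dic_generate: "generate (Dic n) {dic_a n, dic_b n, dic_c n} = carrier (Dic n)"
proof -
  have "range (pres_gen (dic_rels n)) = {dic_a n, dic_b n, dic_c n}"
    unfolding dic_a_def dic_b_def dic_c_def
  proof (intro equalityI subsetI)
    fix y assume "y \<in> range (pres_gen (dic_rels n))"
    then obtain x where "y = pres_gen (dic_rels n) x" by blast
    then show "y \<in> {pres_gen (dic_rels n) GenA, pres_gen (dic_rels n) GenB, pres_gen (dic_rels n) GenC}"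
      by (cases x) simp_all
  qed auto
  then show ?thesis using pres_generate[of "dic_rels n"] by (simp add: Dic_def)
qed

text \<open>
  A concrete model, used only to see that the presentation does not collapse:
  \<open>(i, p)\<close> stands for \<open>a\<^sup>i\<close> or \<open>a\<^sup>i b\<close>.
\<close>

definition dic_model_mult :: "nat \<Rightarrow> int \<times> bool \<Rightarrow> int \<times> bool \<Rightarrow> int \<times> bool" where
  "dic_model_mult n x y =
    (((if snd x then fst x - fst y else fst x + fst y) + (if snd x \<and> snd y then int n else 0))
      mod (2 * int n), snd x \<noteq> snd y)"

definition dic_model :: "nat \<Rightarrow> (int \<times> bool) monoid" where
  "dic_model n = \<lparr>carrier = {0..<2 * int n} \<times> UNIV, mult = dic_model_mult n, one = (0, False)\<rparr>"

lemma dic_model_group: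
  assumes "n \<ge> 1"
  shows "group (dic_model n)"
proof (rule groupI)
  fix x y z
  assume "x \<in> carrier (dic_model n)" "y \<in> carrier (dic_model n)" "z \<in> carrier (dic_model n)"
  have *: "(int n + u - v) mod (int n * 2) = (u - (int n + v)) mod (int n * 2)" for u v
    by (simp add: mod_eq_dvd_iff)
  show "x \<otimes>\<^bsub>dic_model n\<^esub> y \<otimes>\<^bsub>dic_model n\<^esub> z = x \<otimes>\<^bsub>dic_model n\<^esub> (y \<otimes>\<^bsub>dic_model n\<^esub> z)"
  proof -
    have mods: "(a mod m + b) mod m = (a + b) mod m" "(b + a mod m) mod m = (b + a) mod m"
       "(a mod m - b) mod m = (a - b) mod m" "(b - a mod m) mod m = (b - a) mod m"
      for a b m :: int
      by (simp_all add: mod_simps)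
    have mods2: "(a mod m + b + c) mod m = (a + b + c) mod m"
      "(b + a mod m + c) mod m = (b + a + c) mod m"
      "(a mod m - b + c) mod m = (a - b + c) mod m"
      "(b - a mod m + c) mod m = (b - a + c) mod m"
      for a b c m :: int
      by (metis mod_add_left_eq mods)+
    have mods3: "(c + a mod m - b) mod m = (c + a - b) mod m" for a b c m :: int
      by (metis mod_diff_left_eq mods(2))
    show ?thesis
      by (cases "snd x"; cases "snd y"; cases "snd z")
        (simp_all add: dic_model_def dic_model_mult_def mods mods2 mods3 algebra_simps *)
  qed
next
  fix x assume x: "x \<in> carrier (dic_model n)"
  show "\<exists>y\<in>carrier (dic_model n). y \<otimes>\<^bsub>dic_model n\<^esub> x = \<one>\<^bsub>dic_model n\<^esub>"
  proof (cases "snd x")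
    case True
    have "((fst x + int n) mod (2 * int n), True) \<otimes>\<^bsub>dic_model n\<^esub> x = \<one>\<^bsub>dic_model n\<^esub>"
    proof -
      have "((fst x + int n) mod (2 * int n) + (int n - fst x)) mod (2 * int n)
          = ((fst x + int n) + (int n - fst x)) mod (2 * int n)"
        by (rule mod_add_left_eq)
      also have "\<dots> = 0" by simp
      finally have "((fst x + int n) mod (2 * int n) - fst x + int n) mod (2 * int n) = 0"
        by (simp add: algebra_simps)
      then show ?thesis using True by (simp add: dic_model_def dic_model_mult_def)
    qed
    then show ?thesis using assms by (intro bexI) (auto simp: dic_model_def)
  next
    case False
    have "((- fst x) mod (2 * int n), False) \<otimes>\<^bsub>dic_model n\<^esub> x = \<one>\<^bsub>dic_model n\<^esub>"
      using False by (simp add: dic_model_def dic_model_mult_def mod_simps)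
    then show ?thesis using assms by (intro bexI) (auto simp: dic_model_def)
  qed
qed (use assms in \<open>auto simp: dic_model_def dic_model_mult_def\<close>)

lemma dic_model_hom:
  assumes "n \<ge> 1"
  shows "\<exists>h \<in> hom (Dic n) (dic_model n).
    h (dic_a n) = (1, False) \<and> h (dic_b n) = (0, True) \<and> h (dic_c n) = (1, True)"
proof -
  define f :: "dic_gen \<Rightarrow> int \<times> bool" where
    "f = case_dic_gen (1, False) (0, True) (1, True)"
  have f[simp]: "f GenA = (1, False)" "f GenB = (0, True)" "f GenC = (1, True)"
    by (simp_all add: f_def)
  have fc: "f x \<in> carrier (dic_model n)" for x
    using assms by (cases x) (auto simp: dic_model_def)
  have pw: "word_val (dic_model n) f (replicate k (GenA, True)) = (int k mod (2 * int n), False)" for k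
    by (induction k) (simp_all add: word_val_def dic_model_def dic_model_mult_def mod_simps)
  have "word_val (dic_model n) f l = word_val (dic_model n) f r" if "(l, r) \<in> dic_rels n" for l r
    using that assms unfolding dic_rels_def
    by (auto simp: pw) (simp_all add: word_val_def dic_model_def dic_model_mult_def numeral_2_eq_2 mod_simps)
  from presented_group_hom[OF dic_model_group[OF assms] fc this]
  show ?thesis unfolding Dic_def dic_a_def dic_b_def dic_c_def by (metis f)
qed

lemma dic_normal_form:
  assumes "n \<ge> 1"
  shows "carrier (Dic n) =
    (\<lambda>(i, p). dic_a n [^]\<^bsub>Dic n\<^esub> i \<otimes>\<^bsub>Dic n\<^esub> (if p then dic_b n else \<one>\<^bsub>Dic n\<^esub>)) ` ({..<2 * n} \<times> UNIV)"
proof -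
  interpret group "Dic n" by (rule group_Dic)
  let ?G = "Dic n"
  define a where "a = dic_a n"
  define b where "b = dic_b n"
  define c where "c = dic_c n"
  note [simp] = dic_carrier[of n, folded a_def b_def c_def]
  note rels = dic_relations[of n, folded a_def b_def c_def]
  let ?N = "(\<lambda>(i, p). a [^]\<^bsub>?G\<^esub> i \<otimes>\<^bsub>?G\<^esub> (if p then b else \<one>\<^bsub>?G\<^esub>)) ` ({..<2 * n} \<times> UNIV)"
  have c: "c = a \<otimes>\<^bsub>?G\<^esub> b"
    using rels(3) right_cancel[of c c "a \<otimes>\<^bsub>?G\<^esub> b"] by simp
  have aba: "a \<otimes>\<^bsub>?G\<^esub> (b \<otimes>\<^bsub>?G\<^esub> a) = b"
  proof -
    have "a \<otimes>\<^bsub>?G\<^esub> (b \<otimes>\<^bsub>?G\<^esub> a) \<otimes>\<^bsub>?G\<^esub> b = b \<otimes>\<^bsub>?G\<^esub> b"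
      using rels(2) by (simp add: c m_assoc)
    then show ?thesis by simp
  qed
  have akb: "a [^]\<^bsub>?G\<^esub> k \<otimes>\<^bsub>?G\<^esub> (b \<otimes>\<^bsub>?G\<^esub> a [^]\<^bsub>?G\<^esub> k) = b" for k :: nat
  proof (induction k)
    case (Suc k)
    have "a [^]\<^bsub>?G\<^esub> Suc k \<otimes>\<^bsub>?G\<^esub> (b \<otimes>\<^bsub>?G\<^esub> a [^]\<^bsub>?G\<^esub> Suc k)
      = a \<otimes>\<^bsub>?G\<^esub> ((a [^]\<^bsub>?G\<^esub> k \<otimes>\<^bsub>?G\<^esub> (b \<otimes>\<^bsub>?G\<^esub> a [^]\<^bsub>?G\<^esub> k)) \<otimes>\<^bsub>?G\<^esub> a)"
    proof -
      have "a [^]\<^bsub>?G\<^esub> Suc k = a \<otimes>\<^bsub>?G\<^esub> a [^]\<^bsub>?G\<^esub> k" by (rule nat_pow_Suc2) simp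
      moreover have "a [^]\<^bsub>?G\<^esub> Suc k = a [^]\<^bsub>?G\<^esub> k \<otimes>\<^bsub>?G\<^esub> a" by simp
      ultimately show ?thesis
        using m_assoc by (metis dic_carrier(1,2) a_def b_def m_closed nat_pow_closed)
    qed
    then show ?case using Suc aba by simp
  qed simp
  have a2n: "a [^]\<^bsub>?G\<^esub> (2 * n) = \<one>\<^bsub>?G\<^esub>"
  proof -
    have "a [^]\<^bsub>?G\<^esub> n \<otimes>\<^bsub>?G\<^esub> (b \<otimes>\<^bsub>?G\<^esub> a [^]\<^bsub>?G\<^esub> n) = a [^]\<^bsub>?G\<^esub> n \<otimes>\<^bsub>?G\<^esub> (a [^]\<^bsub>?G\<^esub> n \<otimes>\<^bsub>?G\<^esub> b)"
      by (simp add: rels(1) m_assoc)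
    then have "(a [^]\<^bsub>?G\<^esub> n \<otimes>\<^bsub>?G\<^esub> a [^]\<^bsub>?G\<^esub> n) \<otimes>\<^bsub>?G\<^esub> b = b"
      using akb[of n] by (simp add: m_assoc)
    then have "a [^]\<^bsub>?G\<^esub> n \<otimes>\<^bsub>?G\<^esub> a [^]\<^bsub>?G\<^esub> n = \<one>\<^bsub>?G\<^esub>"
      using r_cancel_one[of b "a [^]\<^bsub>?G\<^esub> n \<otimes>\<^bsub>?G\<^esub> a [^]\<^bsub>?G\<^esub> n"] by simp
    then show ?thesis by (simp add: nat_pow_mult mult_2)
  qed
  have amod: "a [^]\<^bsub>?G\<^esub> (k mod (2 * n)) = a [^]\<^bsub>?G\<^esub> k" for k :: nat
  proof -
    have "a [^]\<^bsub>?G\<^esub> k = a [^]\<^bsub>?G\<^esub> ((2 * n) * (k div (2 * n)) + k mod (2 * n))" by simp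
    also have "\<dots> = (a [^]\<^bsub>?G\<^esub> (2 * n)) [^]\<^bsub>?G\<^esub> (k div (2 * n)) \<otimes>\<^bsub>?G\<^esub> a [^]\<^bsub>?G\<^esub> (k mod (2 * n))"
      by (simp only: nat_pow_mult[symmetric] nat_pow_pow dic_carrier a_def)
    finally show ?thesis by (simp add: a2n)
  qed
  have N1: "a [^]\<^bsub>?G\<^esub> (k::nat) \<in> ?N" for k
    using assms by (intro image_eqI[of _ _ "(k mod (2 * n), False)"]) (simp_all add: amod)
  have N2: "a [^]\<^bsub>?G\<^esub> (k::nat) \<otimes>\<^bsub>?G\<^esub> b \<in> ?N" for k
    using assms by (intro image_eqI[of _ _ "(k mod (2 * n), True)"]) (simp_all add: amod)
  have Na: "x \<otimes>\<^bsub>?G\<^esub> a \<in> ?N" if "x \<in> ?N" for x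
  proof -
    obtain i p where x: "x = a [^]\<^bsub>?G\<^esub> (i::nat) \<otimes>\<^bsub>?G\<^esub> (if p then b else \<one>\<^bsub>?G\<^esub>)" using \<open>x \<in> ?N\<close> by auto
    show ?thesis
    proof (cases p)
      case False
      then show ?thesis using N1[of "Suc i"] x by simp
    next
      case True
      have e: "a [^]\<^bsub>?G\<^esub> (2 * n - 1) \<otimes>\<^bsub>?G\<^esub> a = \<one>\<^bsub>?G\<^esub>"
      proof -
        have "Suc (2 * n - 1) = 2 * n" using assms by simp
        then have "a [^]\<^bsub>?G\<^esub> Suc (2 * n - 1) = \<one>\<^bsub>?G\<^esub>" by (simp only: a2n)
        then show ?thesis by (simp only: nat_pow_Suc)
      qed
      have "b \<otimes>\<^bsub>?G\<^esub> a = a [^]\<^bsub>?G\<^esub> (2 * n - 1) \<otimes>\<^bsub>?G\<^esub> a \<otimes>\<^bsub>?G\<^esub> (b \<otimes>\<^bsub>?G\<^esub> a)"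
        unfolding e by simp
      also have "\<dots> = a [^]\<^bsub>?G\<^esub> (2 * n - 1) \<otimes>\<^bsub>?G\<^esub> b"
        using aba by (simp add: m_assoc)
      finally have "x \<otimes>\<^bsub>?G\<^esub> a = a [^]\<^bsub>?G\<^esub> (i + (2 * n - 1)) \<otimes>\<^bsub>?G\<^esub> b"
        using True by (simp add: x m_assoc nat_pow_mult[symmetric])
      then show ?thesis using N2 by simp
    qed
  qed
  have Nb: "x \<otimes>\<^bsub>?G\<^esub> b \<in> ?N" if "x \<in> ?N" for x
  proof -
    obtain i p where x: "x = a [^]\<^bsub>?G\<^esub> (i::nat) \<otimes>\<^bsub>?G\<^esub> (if p then b else \<one>\<^bsub>?G\<^esub>)" using \<open>x \<in> ?N\<close> by auto
    show ?thesis
    proof (cases p)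
      case False
      then show ?thesis using N2[of i] x by simp
    next
      case True
      then show ?thesis using N1[of "i + n"]
        by (simp add: x m_assoc rels(1)[symmetric] nat_pow_mult)
    qed
  qed
  have Ncl: "?N \<subseteq> carrier ?G" by auto
  have Nc: "x \<otimes>\<^bsub>?G\<^esub> c \<in> ?N" if "x \<in> ?N" for x
  proof -
    have "x \<otimes>\<^bsub>?G\<^esub> c = x \<otimes>\<^bsub>?G\<^esub> a \<otimes>\<^bsub>?G\<^esub> b" using that Ncl by (auto simp: c m_assoc)
    then show ?thesis using Na[OF that] Nb by metis
  qed
  have fin: "finite ?N" by simp
  have inv: "x \<otimes>\<^bsub>?G\<^esub> inv\<^bsub>?G\<^esub> s \<in> ?N"
    if s: "s \<in> carrier ?G" and cl: "\<And>y. y \<in> ?N \<Longrightarrow> y \<otimes>\<^bsub>?G\<^esub> s \<in> ?N" and x: "x \<in> ?N" for x s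
  proof -
    have "inj_on (\<lambda>y. y \<otimes>\<^bsub>?G\<^esub> s) ?N"
      by (rule inj_onI) (use Ncl s in \<open>meson right_cancel subsetD\<close>)
    then have "(\<lambda>y. y \<otimes>\<^bsub>?G\<^esub> s) ` ?N = ?N"
      using cl by (intro endo_inj_surj[OF fin]) auto
    then obtain y where y: "y \<in> ?N" "x = y \<otimes>\<^bsub>?G\<^esub> s" using x by (metis (no_types, lifting) imageE)
    then have "x \<otimes>\<^bsub>?G\<^esub> inv\<^bsub>?G\<^esub> s = y" using Ncl s by (simp add: m_assoc subsetD)
    then show ?thesis using y by simp
  qed
  have "pres_class (dic_rels n) u \<in> ?N" for u
  proof (induction u rule: rev_induct)
    case Nil
    show ?case using N1[of 0] by (simp add: Dic_def pres_one)
  next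
    case (snoc l u)
    obtain g e where l: "l = (g, e)" by force
    have step: "x \<otimes>\<^bsub>?G\<^esub> pres_gen (dic_rels n) g \<in> ?N" if "x \<in> ?N" for x
      using Na[OF that] Nb[OF that] Nc[OF that]
      unfolding a_def b_def c_def dic_a_def dic_b_def dic_c_def by (cases g) simp_all
    have gc: "pres_gen (dic_rels n) g \<in> carrier ?G" by (simp add: Dic_def pres_gen_carrier)
    show ?case
      using step[OF snoc] inv[OF gc step snoc] unfolding l
      by (cases e) (simp_all add: pres_class_snoc_True pres_class_snoc_False flip: Dic_def)
  qed
  then have "carrier ?G \<subseteq> ?N" by (auto simp: Dic_def pres_carrier)
  with Ncl have "carrier ?G = ?N" by (intro subset_antisym)
  then show ?thesis unfolding a_def b_def .
qed

lemma dic_order: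
  assumes "n \<ge> 1"
  shows "order (Dic n) = 4 * n"
proof -
  interpret G: group "Dic n" by (rule group_Dic)
  interpret M: group "dic_model n" by (rule dic_model_group[OF assms])
  from dic_model_hom[OF assms] obtain h where h: "h \<in> hom (Dic n) (dic_model n)"
    and hg: "h (dic_a n) = (1, False)" "h (dic_b n) = (0, True)" by auto
  interpret group_hom "Dic n" "dic_model n" h
    by unfold_locales (rule h)
  have hp: "h (dic_a n [^]\<^bsub>Dic n\<^esub> k) = (int k mod (2 * int n), False)" for k :: nat
  proof (induction k)
    case 0
    show ?case by (simp add: dic_model_def)
  next
    case (Suc k)
    then show ?case by (simp add: hg) (simp add: dic_model_def dic_model_mult_def mod_simps add.commute)
  qed
  let ?f = "\<lambda>(i::nat, p). dic_a n [^]\<^bsub>Dic n\<^esub> i \<otimes>\<^bsub>Dic n\<^esub> (if p then dic_b n else \<one>\<^bsub>Dic n\<^esub>)"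
  have "h (?f (i, p)) = (int i, p)" if "i < 2 * n" for i p
    using that by (simp add: hp hg) (simp add: dic_model_def dic_model_mult_def)
  then have "inj_on ?f ({..<2 * n} \<times> UNIV)"
    by (intro inj_on_inverseI[where g = "\<lambda>x. map_prod nat id (h x)"]) auto
  then show ?thesis
    unfolding order_def dic_normal_form[OF assms] by (simp add: card_image card_cartesian_product)
qed

section \<open>The game REL\<close>

datatype player = Player1 | Player2

locale rel_game = group G for G (structure) +
  fixes S :: "'a set"
  assumes finite_carrier: "finite (carrier G)"
    and generators: "S \<subseteq> carrier G" "generate G S = carrier G"
    and one_notin: "\<one> \<notin> S"
begin

text \<open>
  A position is the list \<open>[s\<^sub>1, \<dots>, s\<^sub>n]\<close> of the moves made so far, in chronological order;
  \<open>word_elt (take k xs)\<close> is the element represented by \<open>w\<^sub>k\<close>.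
\<close>

definition word_elt :: "'a list \<Rightarrow> 'a" where
  "word_elt xs = foldl (\<otimes>) \<one> xs"

definition legal_move :: "'a list \<Rightarrow> 'a \<Rightarrow> bool" where
  "legal_move xs s \<longleftrightarrow>
    s \<in> S \<union> (\<lambda>x. inv x) ` S \<and> (xs \<noteq> [] \<longrightarrow> s \<noteq> inv (last xs))"

definition revisits :: "'a list \<Rightarrow> bool" where
  "revisits xs \<longleftrightarrow> (\<exists>k < length xs. word_elt xs = word_elt (take k xs))"

definition stuck :: "'a list \<Rightarrow> bool" where
  "stuck xs \<longleftrightarrow> \<not> (\<exists>s. legal_move xs s)"

definition game_over :: "'a list \<Rightarrow> bool" where
  "game_over xs \<longleftrightarrow> revisits xs \<or> stuck xs"

definition to_move :: "'a list \<Rightarrow> player" where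
  "to_move xs = (if even (length xs) then Player1 else Player2)"

definition last_mover :: "'a list \<Rightarrow> player" where
  "last_mover xs = (if odd (length xs) then Player1 else Player2)"

definition won_by :: "player \<Rightarrow> 'a list \<Rightarrow> bool" where
  "won_by p xs \<longleftrightarrow>
    (revisits xs \<and> last_mover xs = p) \<or> (\<not> revisits xs \<and> stuck xs \<and> to_move xs \<noteq> p)"

text \<open>
  \<open>follows p \<sigma> xs\<close>: the position \<open>xs\<close> can arise when player \<open>p\<close> uses the strategy \<open>\<sigma>\<close>
  (a function of the whole history) and the opponent plays arbitrary legal moves.
\<close>

inductive follows :: "player \<Rightarrow> ('a list \<Rightarrow> 'a) \<Rightarrow> 'a list \<Rightarrow> bool"
  for p \<sigma> where
  start: "follows p \<sigma> []"
| own_move: "follows p \<sigma> xs \<Longrightarrow> \<not> game_over xs \<Longrightarrow> to_move xs = p \<Longrightarrow>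
    legal_move xs (\<sigma> xs) \<Longrightarrow> follows p \<sigma> (xs @ [\<sigma> xs])"
| opponent_move: "follows p \<sigma> xs \<Longrightarrow> \<not> game_over xs \<Longrightarrow> to_move xs \<noteq> p \<Longrightarrow>
    legal_move xs s \<Longrightarrow> follows p \<sigma> (xs @ [s])"

definition winning_strategy :: "player \<Rightarrow> ('a list \<Rightarrow> 'a) \<Rightarrow> bool" where
  "winning_strategy p \<sigma> \<longleftrightarrow>
    (\<forall>xs. follows p \<sigma> xs \<longrightarrow> \<not> game_over xs \<longrightarrow> to_move xs = p \<longrightarrow> legal_move xs (\<sigma> xs)) \<and>
    (\<forall>xs. follows p \<sigma> xs \<longrightarrow> game_over xs \<longrightarrow> won_by p xs) \<and>
    \<not> (\<exists>f. \<forall>k. follows p \<sigma> (map f [0..<k]))"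

definition has_winning_strategy :: "player \<Rightarrow> bool" where
  "has_winning_strategy p \<longleftrightarrow> (\<exists>\<sigma>. winning_strategy p \<sigma>)"

end

text \<open>\<open>Dic n\<close> with these generators satisfies the standing assumptions of the game.\<close>

lemma rel_game_Dic:
  assumes "n \<ge> 1"
  shows "rel_game (Dic n) {dic_a n, dic_b n, dic_c n}"
proof -
  interpret G: group "Dic n" by (rule group_Dic)
  interpret M: group "dic_model n" by (rule dic_model_group[OF assms])
  from dic_model_hom[OF assms] obtain h where h: "h \<in> hom (Dic n) (dic_model n)"
    and hg: "h (dic_a n) = (1, False)" "h (dic_b n) = (0, True)" "h (dic_c n) = (1, True)" by auto
  interpret group_hom "Dic n" "dic_model n" h
    by unfold_locales (rule h)
  have "h \<one>\<^bsub>Dic n\<^esub> = (0, False)" unfolding hom_one by (simp add: dic_model_def)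
  then have "\<one>\<^bsub>Dic n\<^esub> \<notin> {dic_a n, dic_b n, dic_c n}"
    using hg by (auto simp del: hom_one)
  moreover have "finite (carrier (Dic n))"
    unfolding dic_normal_form[OF assms] by simp
  ultimately show ?thesis
    by unfold_locales (auto simp: dic_generate)
qed

end

theory Submission
  imports Defs
begin

text \<open>
  A player who can step onto a visited vertex other than the previous one wins at once, so the
  game amounts to extending an induced path in the Cayley graph. With \<open>F\<^sub>i = a\<^sup>i\<close> and
  \<open>T\<^sub>i = a\<^sup>i b\<close>, indices modulo \<open>2n\<close>, the neighbours of \<open>F\<^sub>i\<close> are \<open>F\<close> at \<open>i \<plusminus> 1\<close> and \<open>T\<close> at
  \<open>i, i + n, i + 1, i + 1 + n\<close>. Up to the automorphisms \<open>T\<^sub>i \<mapsto> T\<close> at \<open>i + n\<close> and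
  \<open>(F\<^sub>i, T\<^sub>i) \<mapsto> (F\<close> at \<open>-i, T\<close> at \<open>1 - i)\<close>, Player 2 always moves on in the direction chosen by
  Player 1: the path \<open>F\<^sub>0, \<dots>, F\<^sub>k\<close> (\<open>k\<close> even) is prolonged by two at a time until Player 1 leaves
  it for \<open>T\<close> at \<open>k + 1\<close>; then the \<open>T\<close>'s are run through upwards, by two at a time, until Player 1
  leaves them at some \<open>T\<^sub>j\<close> (\<open>j\<close> even) for \<open>F\<close> at \<open>j\<close> or \<open>j + n\<close>. Player 2 answers with the
  antipode \<open>T\<close> at \<open>j + n\<close>, and the path is forced down to \<open>T\<close> at \<open>k + 2 + n\<close>, where Player 1 is
  to move and cannot avoid a neighbour of a visited vertex. As \<open>n\<close> is odd, parity also favours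
  Player 2 if the run along the \<open>F\<close>'s or along the \<open>T\<close>'s is carried to its end.
\<close>

section \<open>REL on a finite group as a game on its Cayley graph\<close>

context rel_game
begin

definition nbrs :: "'a \<Rightarrow> 'a set" where
  "nbrs u = {u \<otimes> s |s. s \<in> S \<union> (\<lambda>x. inv x) ` S}"

definition visited :: "'a list \<Rightarrow> 'a set" where
  "visited xs = (\<lambda>k. word_elt (take k xs)) ` {..length xs}"

lemma gens_carrier: "s \<in> S \<union> (\<lambda>x. inv x) ` S \<Longrightarrow> s \<in> carrier G"
  using generators(1) by auto

lemma word_elt_Nil [simp]: "word_elt [] = \<one>"
  by (simp add: word_elt_def)

lemma word_elt_snoc [simp]: "word_elt (xs @ [s]) = word_elt xs \<otimes> s"
  by (simp add: word_elt_def)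

lemma word_elt_closed: "set xs \<subseteq> carrier G \<Longrightarrow> word_elt xs \<in> carrier G"
  by (induction xs rule: rev_induct) auto

lemma visited_Nil [simp]: "visited [] = {\<one>}"
  by (simp add: visited_def)

lemma visited_snoc [simp]: "visited (xs @ [s]) = insert (word_elt (xs @ [s])) (visited xs)"
proof -
  have "{..length (xs @ [s])} = insert (Suc (length xs)) {..length xs}" by auto
  then show ?thesis by (simp add: visited_def del: word_elt_snoc)
qed

lemma revisits_Nil [simp]: "\<not> revisits []"
  by (simp add: revisits_def)

lemma revisits_snoc: "revisits (xs @ [s]) \<longleftrightarrow> word_elt (xs @ [s]) \<in> visited xs"
  unfolding revisits_def visited_def by (auto simp: less_Suc_eq_le simp del: word_elt_snoc)

text \<open>Cancelling the last letter is the same as stepping back to the previous vertex. This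
  turns the rule on letters into a rule on vertices.\<close>

lemma legal_move_snoc:
  assumes "set (xs @ [t]) \<subseteq> carrier G"
  shows "legal_move (xs @ [t]) s \<longleftrightarrow>
    s \<in> S \<union> (\<lambda>x. inv x) ` S \<and> word_elt (xs @ [t]) \<otimes> s \<noteq> word_elt xs"
proof -
  have c: "word_elt xs \<in> carrier G" "t \<in> carrier G" using assms word_elt_closed by auto
  have "word_elt (xs @ [t]) \<otimes> s = word_elt xs \<longleftrightarrow> s = inv t" if "s \<in> carrier G"
  proof -
    have "word_elt (xs @ [t]) \<otimes> s = word_elt xs \<longleftrightarrow> t \<otimes> s = \<one>"
      using c that by (simp add: m_assoc)
    also have "\<dots> \<longleftrightarrow> s = inv t"
      using c that inv_equality[of t s] by auto
    finally show ?thesis .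
  qed
  then show ?thesis using gens_carrier[of s] unfolding legal_move_def by auto
qed

lemma legal_move_closed: "legal_move xs s \<Longrightarrow> s \<in> carrier G"
  unfolding legal_move_def using gens_carrier by blast

lemma follows_carrier: "follows p \<sigma> xs \<Longrightarrow> set xs \<subseteq> carrier G"
  by (induction rule: follows.induct) (simp_all add: legal_move_closed)

lemma follows_prefix_not_over:
  assumes "follows p \<sigma> ys" "ys = xs @ [s]"
  shows "\<not> game_over xs"
  using assms by cases auto

text \<open>No proper prefix of a play contains a revisit, so an infinite play would run through
  infinitely many distinct elements of a finite group.\<close>

lemma no_infinite_play: "\<not> (\<exists>f. \<forall>k. follows p \<sigma> (map f [0..<k]))"
proof
  assume "\<exists>f. \<forall>k. follows p \<sigma> (map f [0..<k])"
  then obtain f where f: "follows p \<sigma> (map f [0..<k])" for k by blast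
  let ?e = "\<lambda>k. word_elt (map f [0..<k])"
  have nr: "\<not> revisits (map f [0..<k])" for k
    using follows_prefix_not_over[OF f[of "Suc k"], of "map f [0..<k]" "f k"]
    by (simp add: game_over_def)
  have "?e j \<noteq> ?e k" if "j < k" for j k
  proof -
    have "take j (map f [0..<k]) = map f [0..<j]" using that by (simp add: take_map)
    then show ?thesis using nr[of k] that unfolding revisits_def by (metis diff_zero length_map length_upt)
  qed
  then have "inj ?e" by (rule linorder_injI)
  moreover have "range ?e \<subseteq> carrier G"
    using word_elt_closed[OF follows_carrier[OF f]] by (rule image_subsetI)
  ultimately show False
    using finite_subset[OF _ finite_carrier] finite_imageD[of ?e UNIV] by auto
qed

text \<open>\<open>Q\<close> is an invariant of the positions in which Player 1 is to move, in terms
  of visited set, previous and current vertex. It ensures that Player 1 never revisits and that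
  Player 2 always has an answer which wins at once or restores \<open>Q\<close>. No decreasing
  measure is required, as plays are finite by \<open>no_infinite_play\<close>.\<close>

lemma winning_strategy_from_invariant:
  assumes Q1: "Q {\<one>} \<one> \<one>"
    and step: "\<And>V p c v. Q V p c \<Longrightarrow> v \<in> nbrs c \<Longrightarrow> v \<noteq> p \<Longrightarrow>
      v \<notin> V \<and> (\<exists>w \<in> nbrs v. w \<noteq> c \<and> (w \<in> V \<or> Q (insert w (insert v V)) v w))"
  shows "has_winning_strategy Player2"
proof -
  define I where "I xs \<longleftrightarrow> \<not> revisits xs \<and>
    Q (visited xs) (if xs = [] then \<one> else word_elt (butlast xs)) (word_elt xs)" for xs
  define good where "good xs t \<longleftrightarrow> legal_move xs t \<and> (revisits (xs @ [t]) \<or> I (xs @ [t]))" for xs t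
  define \<sigma> where "\<sigma> xs = (SOME t. good xs t)" for xs
  have answer: "\<not> revisits (xs @ [s]) \<and> (\<exists>t. good (xs @ [s]) t)"
    if I: "I xs" and s: "legal_move xs s" and xs: "set xs \<subseteq> carrier G" for xs s
  proof -
    let ?V = "visited xs" and ?p = "if xs = [] then \<one> else word_elt (butlast xs)"
      and ?c = "word_elt xs" and ?v = "word_elt (xs @ [s])"
    have sc: "s \<in> carrier G" "s \<in> S \<union> (\<lambda>x. inv x) ` S"
      using s legal_move_closed by (auto simp: legal_move_def)
    have vn: "?v \<in> nbrs ?c" using sc by (auto simp: nbrs_def)
    have vp: "?v \<noteq> ?p"
    proof (cases xs rule: rev_cases)
      case Nil
      \<comment> \<open>The dummy previous vertex \<one> of the empty position excludes no first
        move, since neither a generator nor its inverse is \<one>.\<close>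
      have "inv x \<noteq> \<one>" if "x \<in> S" for x
        using that one_notin generators(1) inv_eq_1_iff[of x] by (metis subsetD)
      then have "s \<noteq> \<one>" using sc(2) one_notin by force
      then show ?thesis using Nil sc word_elt_snoc[of "[]" s] by simp
    next
      case (snoc ys t)
      then have "legal_move (ys @ [t]) s" "set (ys @ [t]) \<subseteq> carrier G" using s xs by simp_all
      then have "?c \<otimes> s \<noteq> word_elt ys" using legal_move_snoc[of ys t s] snoc by blast
      then show ?thesis unfolding word_elt_snoc using snoc by simp
    qed
    from step[OF I[unfolded I_def, THEN conjunct2] vn vp]
    obtain w where w: "?v \<notin> ?V" "w \<in> nbrs ?v" "w \<noteq> ?c"
      "w \<in> ?V \<or> Q (insert w (insert ?v ?V)) ?v w" by blast
    then obtain t where t: "t \<in> S \<union> (\<lambda>x. inv x) ` S" "w = ?v \<otimes> t" by (auto simp: nbrs_def)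
    have wt: "word_elt (xs @ [s] @ [t]) = w" using t word_elt_snoc[of "xs @ [s]" t] by simp
    have "legal_move (xs @ [s]) t" using legal_move_snoc[of xs s t] t w xs sc by auto
    moreover have "revisits ((xs @ [s]) @ [t]) \<or> I ((xs @ [s]) @ [t])"
      using w(4) t wt visited_snoc[of "xs @ [s]" t]
      by (auto simp: I_def revisits_snoc butlast_append simp del: append_assoc)
    ultimately show ?thesis using w(1) by (auto simp: revisits_snoc good_def)
  qed
  \<comment> \<open>Even length means that Player 1 is to move. A revisit there was made by Player 2
    and ends the game.\<close>
  have inv: "if even (length xs) then revisits xs \<or> I xs
     else \<not> revisits xs \<and> (\<exists>t. good xs t)" if "follows Player2 \<sigma> xs" for xs
    using that
  proof induction
    case start
    show ?case using Q1 by (simp add: I_def)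
  next
    case (own_move xs)
    then have o: "odd (length xs)" by (auto simp: to_move_def split: if_splits)
    then have "good xs (\<sigma> xs)" using own_move.IH unfolding \<sigma>_def by (auto intro: someI)
    then show ?case using o by (auto simp: good_def)
  next
    case (opponent_move xs s)
    then have e: "even (length xs)" by (auto simp: to_move_def split: if_splits)
    then have "I xs" using opponent_move by (auto simp: game_over_def)
    then show ?case using answer[of xs s] follows_carrier opponent_move e by auto
  qed
  have "winning_strategy Player2 \<sigma>"
    unfolding winning_strategy_def
  proof (intro conjI allI impI no_infinite_play)
    fix xs assume xs: "follows Player2 \<sigma> xs"
    {
      assume "to_move xs = Player2"
      then have "\<exists>t. good xs t" using inv[OF xs] by (auto simp: to_move_def split: if_splits)
      then have "good xs (\<sigma> xs)" unfolding \<sigma>_def by (rule someI_ex)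
      then show "legal_move xs (\<sigma> xs)" by (simp add: good_def)
    }
    assume "game_over xs"
    then show "won_by Player2 xs"
      using inv[OF xs]
      by (auto simp: won_by_def game_over_def last_mover_def to_move_def stuck_def good_def
          split: if_splits)
  qed
  then show ?thesis unfolding has_winning_strategy_def by blast
qed

end

section \<open>The Cayley graph and its symmetries\<close>

text \<open>
  The Cayley graph of the dicyclic group: up to an automorphism, \<open>F i\<close> and \<open>T i\<close> stand for
  \<open>a\<^sup>i\<close> and \<open>a\<^sup>i b\<close>, and \<open>N\<close> maps a vertex to its set of neighbours.
\<close>

locale dic_graph =
  fixes N :: "'a \<Rightarrow> 'a set" and n :: int and F T :: "int \<Rightarrow> 'a"
  assumes F_eq_iff: "F i = F j \<longleftrightarrow> 2 * n dvd i - j"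
    and T_eq_iff: "T i = T j \<longleftrightarrow> 2 * n dvd i - j"
    and F_neq_T: "F i \<noteq> T j"
    and N_F: "N (F i) = {F (i + 1), F (i - 1), T i, T (i + n), T (i + 1), T (i + 1 + n)}"
    and N_T: "N (T i) = {T (i + 1), T (i - 1), F i, F (i + n), F (i - 1), F (i - 1 + n)}"
begin

lemma T_neq_F: "T j \<noteq> F i"
  using F_neq_T by metis

lemma F_wrap: "F (i + n + n) = F i" and T_wrap: "T (i + n + n) = T i"
  by (simp_all add: F_eq_iff T_eq_iff)

lemma F_inj: "\<lbrakk>i - j < 2 * n; j - i < 2 * n\<rbrakk> \<Longrightarrow> F i = F j \<longleftrightarrow> i = j"
  unfolding F_eq_iff using dvd_imp_le_int[of "i - j" "2 * n"] by (cases "i = j") auto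

lemma T_inj: "\<lbrakk>i - j < 2 * n; j - i < 2 * n\<rbrakk> \<Longrightarrow> T i = T j \<longleftrightarrow> i = j"
  unfolding T_eq_iff using dvd_imp_le_int[of "i - j" "2 * n"] by (cases "i = j") auto

lemma F_notin: "\<lbrakk>i < l \<or> u < i; i - l < 2 * n; u - i < 2 * n\<rbrakk> \<Longrightarrow> F i \<notin> F ` {l..u}"
  by (auto simp: F_inj)

lemma T_notin: "\<lbrakk>i < l \<or> u < i; i - l < 2 * n; u - i < 2 * n\<rbrakk> \<Longrightarrow> T i \<notin> T ` {l..u}"
  by (auto simp: T_inj)

text \<open>The neighbour sets contain the vertices of the other kind in antipodal pairs, so
  shifting every \<open>T\<close> by \<open>n\<close> preserves them.\<close>

lemma sheet_swap: "dic_graph N n F (\<lambda>i. T (i + n))"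
  by unfold_locales
    (auto simp: F_eq_iff T_eq_iff F_neq_T N_F N_T T_wrap F_wrap algebra_simps)

text \<open>The \<open>T\<close>-neighbours of \<open>F i\<close> lie at \<open>i\<close> and
  \<open>i + 1\<close> modulo \<open>n\<close>, so reversing the \<open>F\<close>'s about 0 must
  reverse the \<open>T\<close>'s about 1/2.\<close>

lemma reflection: "dic_graph N n (\<lambda>i. F (- i)) (\<lambda>i. T (1 - i))"
proof
  \<comment> \<open>The reflection turns a shift by \<open>n\<close> into one by \<open>- n\<close>,
    which is the same modulo \<open>2 * n\<close>.\<close>
  have F': "F (n - i) = F (- n - i)" and T': "T (n - i) = T (- n - i)" for i
    by (simp_all add: F_eq_iff T_eq_iff)
  have dv: "2 * n dvd j - i \<longleftrightarrow> 2 * n dvd i - j" for i j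
    by (metis dvd_minus_iff minus_diff_eq)
  fix i j
  show "F (- i) = F (- j) \<longleftrightarrow> 2 * n dvd i - j" using dv by (simp add: F_eq_iff)
  show "T (1 - i) = T (1 - j) \<longleftrightarrow> 2 * n dvd i - j" using dv by (simp add: T_eq_iff)
  show "F (- i) \<noteq> T (1 - j)" by (rule F_neq_T)
  show "N (F (- i)) = {F (- (i + 1)), F (- (i - 1)), T (1 - i), T (1 - (i + n)),
      T (1 - (i + 1)), T (1 - (i + 1 + n))}"
    using T'[of i] T'[of "i - 1"]
      arg_cong[of "- i - 1" "- 1 - i" F] arg_cong[of "- i - n" "- n - i" T]
    unfolding N_F by (simp add: algebra_simps insert_commute)
  show "N (T (1 - i)) = {T (1 - (i + 1)), T (1 - (i - 1)), F (- i), F (- (i + n)),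
      F (- (i - 1)), F (- (i - 1 + n))}"
    using F'[of i] F'[of "i - 1"] arg_cong[of "- i - n" "- n - i" F]
    unfolding N_T by (simp add: algebra_simps insert_commute)
qed

end

section \<open>Player 2's strategy and its invariant\<close>

text \<open>
  \<open>safe N n e V p c\<close> describes the positions that Player 2 leaves behind: \<open>V\<close> is the set of
  visited vertices, \<open>c\<close> the current and \<open>p\<close> the previous one. At the start there is no previous
  vertex, and \<open>p = e\<close> forbids nothing.
\<close>

inductive safe :: "('a \<Rightarrow> 'a set) \<Rightarrow> int \<Rightarrow> 'a \<Rightarrow> 'a set \<Rightarrow> 'a \<Rightarrow> 'a \<Rightarrow> bool"
  for N n e where
  start: "safe N n e {e} e e"
| rotating: "\<lbrakk>dic_graph N n F T; F 0 = e; even k; 2 \<le> k; k \<le> 2 * n - 2\<rbrakk> \<Longrightarrow>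
    safe N n e (F ` {0..k}) (F (k - 1)) (F k)"
| ascending: "\<lbrakk>dic_graph N n F T; F 0 = e; even k; even j; 0 \<le> k; k + 2 \<le> j; j \<le> n - 1\<rbrakk> \<Longrightarrow>
    safe N n e (F ` {0..k} \<union> T ` {k + 1..j}) (T (j - 1)) (T j)"
| descending: "\<lbrakk>dic_graph N n F T; F 0 = e; even k; even i; even j;
      0 \<le> k; k + 2 \<le> i; i \<le> j; j \<le> n - 1; x = F j \<or> x = F (j + n)\<rbrakk> \<Longrightarrow>
    safe N n e (insert x (F ` {0..k} \<union> T ` {k + 1..j} \<union> T ` {i + n..j + n}))
      (if i = j then x else T (i + n + 1)) (T (i + n))"

context dic_graph
begin

text \<open>What \<open>winning_strategy_from_invariant\<close> demands after a move of Player 1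
  from \<open>c\<close> to \<open>v\<close>, with \<open>safe\<close> as the invariant.\<close>

abbreviation "answered e V c v \<equiv>
  v \<notin> V \<and> (\<exists>w \<in> N v. w \<noteq> c \<and> (w \<in> V \<or> safe N n e (insert w (insert v V)) v w))"

lemma answerI_visited: "\<lbrakk>v \<notin> V; w \<in> N v; w \<noteq> c; w \<in> V\<rbrakk> \<Longrightarrow> answered e V c v"
  and answerI_safe: "\<lbrakk>v \<notin> V; w \<in> N v; w \<noteq> c; safe N n e (insert w (insert v V)) v w\<rbrakk> \<Longrightarrow>
    answered e V c v"
  by blast+

text \<open>Player 2 goes on to \<open>F (k + 2)\<close>. For \<open>k = 2 * n - 2\<close> this is
  \<open>F 0\<close>, which closes the cycle and wins. The case \<open>k = 0\<close> serves the
  opening move.\<close>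

lemma answer_step_a:
  assumes "F 0 = e" "odd n" "n \<ge> 3" "even k" "0 \<le> k" "k \<le> 2 * n - 2"
  shows "answered e (F ` {0..k}) (F k) (F (k + 1))"
proof -
  have nv: "F (k + 1) \<notin> F ` {0..k}" by (rule F_notin) (use assms in auto)
  show ?thesis
  proof (cases "k = 2 * n - 2")
    case True
    have "F 0 = F (k + 1 + 1)" by (simp add: F_eq_iff True)
    then have "F 0 \<in> N (F (k + 1))" by (simp add: N_F)
    moreover have "F 0 \<in> F ` {0..k}" "F 0 \<noteq> F k" using assms True F_inj[of 0 k] by auto
    ultimately show ?thesis by (intro answerI_visited[OF nv])
  next
    case False
    have "k + 2 \<le> 2 * n - 2" using False assms by presburger
    then have "safe N n e (F ` {0..k + 2}) (F (k + 2 - 1)) (F (k + 2))"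
      using assms by (intro safe.rotating[OF dic_graph_axioms]) auto
    moreover have "{0..k + 2} = insert (k + 2) (insert (k + 1) {0..k})" using assms by auto
    moreover have "F (k + 2) \<in> N (F (k + 1))" "k + 2 - 1 = k + 1" by (simp_all add: N_F add.commute)
    ultimately show ?thesis using F_inj[of "k + 2" k] assms(3)
      by (intro answerI_safe[OF nv, of "F (k + 2)"]) simp_all
  qed
qed

text \<open>Player 2 goes on to \<open>T (k + 2)\<close> while this stays within the bound
  \<open>n - 1\<close>. On a longer path, \<open>T (k + 1)\<close> is adjacent to the visited vertex
  \<open>F (k + 1 - n)\<close>, the antipode of \<open>F (k + 1)\<close>.\<close>

lemma answer_step_T:
  assumes "F 0 = e" "odd n" "n \<ge> 3" "even k" "0 \<le> k" "k \<le> 2 * n - 2"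
  shows "answered e (F ` {0..k}) (F k) (T (k + 1))"
proof -
  have nv: "T (k + 1) \<notin> F ` {0..k}" using T_neq_F by auto
  show ?thesis
  proof (cases "k + 2 \<le> n - 1")
    case True
    then have "safe N n e (F ` {0..k} \<union> T ` {k + 1..k + 2}) (T (k + 2 - 1)) (T (k + 2))"
      using assms by (intro safe.ascending[OF dic_graph_axioms]) auto
    moreover have "{k + 1..k + 2} = {k + 1, k + 2}" by auto
    ultimately show ?thesis using T_neq_F
      by (intro answerI_safe[OF nv, of "T (k + 2)"]) (auto simp: N_T add.commute insert_commute)
  next
    case False
    \<comment> \<open>Here the oddness of \<open>n\<close> enters: \<open>k\<close> and
      \<open>n - 1\<close> are both even.\<close>
    then have k: "n - 1 \<le> k" using assms by presburger
    have "F (k + 1 - n) = F (k + 1 + n)" by (simp add: F_eq_iff)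
    then have "F (k + 1 - n) \<in> N (T (k + 1))" by (simp add: N_T)
    moreover have "k + 1 - n \<in> {0..k}" using k assms by auto
    ultimately show ?thesis using assms F_inj[of "k + 1 - n" k]
      by (intro answerI_visited[OF nv, of "F (k + 1 - n)"]) auto
  qed
qed

lemma answer_rotating:
  assumes "F 0 = e" "odd n" "n \<ge> 3" "even k" "2 \<le> k" "k \<le> 2 * n - 2"
    and v: "v \<in> N (F k)" "v \<noteq> F (k - 1)"
  shows "answered e (F ` {0..k}) (F k) v"
proof -
  \<comment> \<open>These two vertices are adjacent to \<open>F (k - 1)\<close> as well as to
    \<open>F k\<close>, so Player 2 closes a triangle.\<close>
  have backwards: "answered e (F ` {0..k}) (F k) v" if "v = T k \<or> v = T (k + n)"
  proof (rule answerI_visited[of _ _ "F (k - 1)"])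
    show "F (k - 1) \<in> N v" using that F_wrap[of "k - 1"]
      by (auto simp: N_T)
  qed (use that F_neq_T assms F_inj[of "k - 1" k] in auto)
  interpret S: dic_graph N n F "\<lambda>i. T (i + n)" by (rule sheet_swap)
  show ?thesis
  proof -
    consider "v = F (k + 1)" | "v = T k \<or> v = T (k + n)" | "v = T (k + 1)" | "v = T (k + 1 + n)"
      using v by (auto simp: N_F)
    then show ?thesis
    proof cases
      case 1
      with answer_step_a[of e k] assms show ?thesis by simp
    next
      case 2
      then show ?thesis by (rule backwards)
    next
      case 3
      with answer_step_T[of e k] assms show ?thesis by simp
    next
      case 4
      with S.answer_step_T[of e k] assms show ?thesis by simp
    qed
  qed
qed

text \<open>All six neighbours are open to Player 1. The reflection, the sheet swap and their
  composite bring each of them to \<open>F 1\<close> or \<open>T 1\<close>.\<close>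

lemma answer_start:
  assumes "F 0 = e" "odd n" "n \<ge> 3" and v: "v \<in> N e"
  shows "answered e {e} e v"
proof -
  interpret S: dic_graph N n F "\<lambda>i. T (i + n)" by (rule sheet_swap)
  interpret R: dic_graph N n "\<lambda>i. F (- i)" "\<lambda>i. T (1 - i)" by (rule reflection)
  interpret RS: dic_graph N n "\<lambda>i. F (- i)" "\<lambda>i. T (1 - (i + n))" by (rule R.sheet_swap)
  have Tn: "T (- n) = T n" by (simp add: T_eq_iff)
  show ?thesis
  proof -
    have V: "F ` {0..0} = {e}" "(\<lambda>i. F (- i)) ` {0..0} = {e}" using assms(1) by auto
    consider "v = F 1" | "v = F (- 1)" | "v = T 0" | "v = T n" | "v = T 1" | "v = T (1 + n)"
      using v[folded assms(1)] by (auto simp: N_F)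
    then show ?thesis
    proof cases
      case 1
      with answer_step_a[of e 0] assms V show ?thesis by simp
    next
      case 2
      with R.answer_step_a[of e 0] assms V show ?thesis by simp
    next
      case 3
      with R.answer_step_T[of e 0] assms V show ?thesis by simp
    next
      case 4
      with RS.answer_step_T[of e 0] assms V Tn show ?thesis by simp
    next
      case 5
      with answer_step_T[of e 0] assms V show ?thesis by simp
    next
      case 6
      with S.answer_step_T[of e 0] assms V show ?thesis by simp
    qed
  qed
qed

text \<open>Going up is continued by two; from \<open>j = n - 1\<close> it leads to
  \<open>T n\<close>, a neighbour of \<open>F 0\<close>. Leaving for an \<open>F\<close> at
  \<open>j - 1\<close> or \<open>j - 1 + n\<close> lets Player 2 return to \<open>T (j - 1)\<close>.
  Only an \<open>F\<close> at \<open>j\<close> or \<open>j + n\<close> starts the descent.\<close>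

lemma answer_ascending:
  assumes "F 0 = e" "odd n" "even k" "even j" "0 \<le> k" "k + 2 \<le> j" "j \<le> n - 1"
    and v: "v \<in> N (T j)" "v \<noteq> T (j - 1)"
  shows "answered e (F ` {0..k} \<union> T ` {k + 1..j}) (T j) v"
proof -
  let ?V = "F ` {0..k} \<union> T ` {k + 1..j}"
  consider "v = T (j + 1)" | "v = F j \<or> v = F (j + n)" | "v = F (j - 1) \<or> v = F (j - 1 + n)"
    using v by (auto simp: N_T)
  then show ?thesis
  proof cases
    case 1
    have nv: "v \<notin> ?V" unfolding 1 using T_neq_F T_notin[of "j + 1" "k + 1" j] assms by auto
    show ?thesis
    proof (cases "j = n - 1")
      case True
      have "F 0 = F (j + 1 + n)" by (simp add: F_eq_iff True)
      then have "F 0 \<in> N v" by (simp add: N_T 1)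
      moreover have "F 0 \<in> F ` {0..k}" using assms by auto
      ultimately show ?thesis using F_neq_T by (intro answerI_visited[OF nv]) auto
    next
      case False
      then have "j + 2 \<le> n - 1" using assms by presburger
      then have "safe N n e (F ` {0..k} \<union> T ` {k + 1..j + 2}) (T (j + 2 - 1)) (T (j + 2))"
        using assms by (intro safe.ascending[OF dic_graph_axioms]) auto
      moreover have "{k + 1..j + 2} = insert (j + 2) (insert (j + 1) {k + 1..j})" using assms by auto
      ultimately show ?thesis using T_inj[of "j + 2" j] assms
        by (intro answerI_safe[OF nv, of "T (j + 2)"]) (auto simp: N_T 1 add.commute)
    qed
  next
    case 2
    have nv: "v \<notin> ?V"
      using 2 F_neq_T F_notin[of j 0 k] F_notin[of "j + n" 0 k] assms by auto
    have Tv: "T (j + n) \<in> N v" using 2 T_wrap[of j] by (auto simp: N_F)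
    \<comment> \<open>The descent begins with \<open>i = j\<close>, the one case in which the
      previous vertex is an \<open>F\<close>.\<close>
    have "safe N n e (insert v (?V \<union> T ` {j + n..j + n})) (if j = j then v else T (j + n + 1)) (T (j + n))"
      using assms 2 by (intro safe.descending[OF dic_graph_axioms]) auto
    then show ?thesis using 2 assms T_inj[of "j + n" j] Tv
      by (intro answerI_safe[OF nv, of "T (j + n)"]) (simp_all add: insert_commute)
  next
    case 3
    have nv: "v \<notin> ?V"
      using 3 F_neq_T F_notin[of "j - 1" 0 k] F_notin[of "j - 1 + n" 0 k] assms by auto
    show ?thesis
    proof (rule answerI_visited[OF nv, of "T (j - 1)"])
      show "T (j - 1) \<in> N v" using 3 T_wrap[of "j - 1"] by (auto simp: N_F)
    qed (use assms T_inj[of "j - 1" j] in auto)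
  qed
qed

text \<open>Antipodal \<open>F\<close>'s have the same \<open>T\<close>-neighbours. Hence every
  \<open>F\<close> that Player 1 can step to is adjacent to \<open>T i\<close>, which was visited on
  the way up. At the lower end \<open>i = k + 2\<close>, the vertex \<open>T (k + 1 + n)\<close> is
  adjacent to \<open>F k\<close>. Turning upwards is possible only at \<open>i = j\<close> and meets
  \<open>x\<close>.\<close>

lemma answer_descending:
  assumes "F 0 = e" "odd n" "even k" "even i" "even j"
    "0 \<le> k" "k + 2 \<le> i" "i \<le> j" "j \<le> n - 1" and x: "x = F j \<or> x = F (j + n)"
    and v: "v \<in> N (T (i + n))" "v \<noteq> (if i = j then x else T (i + n + 1))"
  shows "answered e (insert x (F ` {0..k} \<union> T ` {k + 1..j} \<union> T ` {i + n..j + n})) (T (i + n)) v"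
proof -
  let ?V = "insert x (F ` {0..k} \<union> T ` {k + 1..j} \<union> T ` {i + n..j + n})"
  have xT: "x \<noteq> T l" for l using x T_neq_F[of l] by metis
  have Fi: "F (i + n + n) = F i" "F (i - 1 + n + n) = F (i - 1)" by (rule F_wrap)+
  have "F (i + n - 1) = F (i - 1 + n)" by (rule arg_cong[of _ _ F]) simp
  with Fi have Ni: "N (T (i + n)) = {T (i + n + 1), T (i + n - 1), F i, F (i + n), F (i - 1), F (i - 1 + n)}"
    unfolding N_T by (simp add: insert_commute)
  consider "v = T (i + n + 1)" "i = j" | "v = T (i + n - 1)" | "v = F i \<or> v = F (i + n)"
    | "v = F (i - 1) \<or> v = F (i - 1 + n)"
    using v unfolding Ni by (cases "i = j") auto
  then show ?thesis
  proof cases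
    case 1
    have nv: "v \<notin> ?V"
      using 1 xT T_neq_F T_notin[of "j + n + 1" "k + 1" j] T_notin[of "j + n + 1" "j + n" "j + n"] assms
      by auto
    have "x \<in> N v" using x 1 F_wrap[of j] by (auto simp: N_T algebra_simps)
    then show ?thesis using xT by (intro answerI_visited[OF nv, of x]) auto
  next
    case 2
    have nv: "v \<notin> ?V"
      using 2 xT T_neq_F T_notin[of "i + n - 1" "k + 1" j] T_notin[of "i + n - 1" "i + n" "j + n"] assms
      by auto
    show ?thesis
    proof (cases "i = k + 2")
      case True
      have "F k \<in> N v" using F_wrap[of k] by (auto simp: N_T 2 True algebra_simps)
      then show ?thesis using assms F_neq_T by (intro answerI_visited[OF nv, of "F k"]) auto
    next
      case False
      then have i: "k + 2 \<le> i - 2" using assms(3,4,7) by presburger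
      then have "safe N n e (insert x (F ` {0..k} \<union> T ` {k + 1..j} \<union> T ` {i - 2 + n..j + n}))
          (if i - 2 = j then x else T (i - 2 + n + 1)) (T (i - 2 + n))"
        using assms by (intro safe.descending[OF dic_graph_axioms]) auto
      moreover have "i - 2 \<noteq> j" using i assms(8) by simp
      moreover have "{i - 2 + n..j + n} = insert (i - 2 + n) (insert (i - 1 + n) {i + n..j + n})"
        using assms(8) by auto
      moreover have v': "v = T (i - 1 + n)" "v = T (i - 2 + n + 1)"
        unfolding 2 by (simp_all add: algebra_simps)
      ultimately have "safe N n e (insert (T (i - 2 + n)) (insert v ?V)) v (T (i - 2 + n))"
        by (simp add: insert_commute)
      moreover have "T (i - 2 + n) \<in> N v" unfolding v'(2) N_T by (simp add: algebra_simps)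
      moreover have "T (i - 2 + n) \<noteq> T (i + n)"
        using assms(6-9) T_inj[of "i - 2 + n" "i + n"] by simp
      ultimately show ?thesis by (intro answerI_safe[OF nv])
    qed
  next
    case 3
    \<comment> \<open>For \<open>i = j\<close> the vertex \<open>x\<close> is the previous one and
      thus forbidden, which leaves its antipode. For \<open>i < j\<close> the indices are
      incongruent modulo \<open>2 * n\<close>.\<close>
    have vx: "v \<noteq> x"
    proof (cases "i = j")
      case False
      then have "F i \<noteq> F j" "F i \<noteq> F (j + n)" "F (i + n) \<noteq> F j" "F (i + n) \<noteq> F (j + n)"
        using assms(6-9) F_inj[of i j] F_inj[of i "j + n"] F_inj[of "i + n" j]
          F_inj[of "i + n" "j + n"] by linarith+
      then show ?thesis using 3 x by (elim disjE) simp_all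
    qed (use v in auto)
    have nv: "v \<notin> ?V"
      using vx 3 F_neq_T F_notin[of i 0 k] F_notin[of "i + n" 0 k] assms by auto
    show ?thesis
    proof (rule answerI_visited[OF nv, of "T i"])
      show "T i \<in> N v" using 3 T_wrap[of i] by (auto simp: N_F)
    qed (use assms T_inj[of i "i + n"] in auto)
  next
    case 4
    have "F (i - 1) \<noteq> F j" "F (i - 1) \<noteq> F (j + n)" "F (i - 1 + n) \<noteq> F j" "F (i - 1 + n) \<noteq> F (j + n)"
      using assms(6-9) F_inj[of "i - 1" j] F_inj[of "i - 1" "j + n"] F_inj[of "i - 1 + n" j]
        F_inj[of "i - 1 + n" "j + n"] by linarith+
    then have vx: "v \<noteq> x" using 4 x by (elim disjE) simp_all
    have nv: "v \<notin> ?V"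
      using vx 4 F_neq_T F_notin[of "i - 1" 0 k] F_notin[of "i - 1 + n" 0 k] assms by auto
    show ?thesis
    proof (rule answerI_visited[OF nv, of "T i"])
      show "T i \<in> N v" using 4 T_wrap[of i] by (auto simp: N_F)
    qed (use assms T_inj[of i "i + n"] in auto)
  qed
qed

text \<open>Each rule of \<open>safe\<close> other than \<open>start\<close> brings its own
  coordinates \<open>F\<close> and \<open>T\<close>, so the case lemmas are applied in those and not
  in the ambient ones.\<close>

lemma safe_answered:
  assumes e: "F 0 = e" and n: "odd n" "n \<ge> 3" and s: "safe N n e V p c" and v: "v \<in> N c" "v \<noteq> p"
  shows "answered e V c v"
  using s v
proof cases
  case start
  then show ?thesis using answer_start[OF e n] v by simp
next
  case (rotating F T k)
  then show ?thesis using dic_graph.answer_rotating[of N n F T e k v] n v by simp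
next
  case (ascending F T k j)
  then show ?thesis using dic_graph.answer_ascending[of N n F T e k j v] n v by simp
next
  case (descending F T k i j x)
  then show ?thesis using dic_graph.answer_descending[of N n F T e k i j x v] n v by simp
qed

end

section \<open>The Cayley graph of the dicyclic group\<close>

lemma dic_graph_Dic:
  assumes n: "n \<ge> 1"
  shows "dic_graph (rel_game.nbrs (Dic n) {dic_a n, dic_b n, dic_c n}) (int n)
    (\<lambda>i. dic_a n [^]\<^bsub>Dic n\<^esub> i) (\<lambda>i. dic_a n [^]\<^bsub>Dic n\<^esub> i \<otimes>\<^bsub>Dic n\<^esub> dic_b n)"
proof -
  interpret G: rel_game "Dic n" "{dic_a n, dic_b n, dic_c n}" by (rule rel_game_Dic[OF n])
  interpret M: group "dic_model n" by (rule dic_model_group[OF n])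
  from dic_model_hom[OF n] obtain h where h: "h \<in> hom (Dic n) (dic_model n)"
    and hg: "h (dic_a n) = (1, False)" "h (dic_b n) = (0, True)" by auto
  interpret group_hom "Dic n" "dic_model n" h
    by unfold_locales (rule h)
  define a where "a = dic_a n"
  define b where "b = dic_b n"
  define c where "c = dic_c n"
  let ?G = "Dic n"
  note [simp] = dic_carrier[of n, folded a_def b_def c_def]
  note rels = dic_relations[of n, folded a_def b_def c_def]
  define F :: "int \<Rightarrow> dic_gen gword set" where "F i = a [^]\<^bsub>?G\<^esub> i" for i
  define T where "T i = F i \<otimes>\<^bsub>?G\<^esub> b" for i
  have Fc [simp]: "F i \<in> carrier ?G" and Tc [simp]: "T i \<in> carrier ?G" for i
    by (simp_all add: F_def T_def)
  have c: "c = a \<otimes>\<^bsub>?G\<^esub> b"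
    using rels(3) G.right_cancel[of c c "a \<otimes>\<^bsub>?G\<^esub> b"] by simp
  have aba: "a \<otimes>\<^bsub>?G\<^esub> (b \<otimes>\<^bsub>?G\<^esub> a) = b"
  proof -
    have "a \<otimes>\<^bsub>?G\<^esub> (b \<otimes>\<^bsub>?G\<^esub> a) \<otimes>\<^bsub>?G\<^esub> b = b \<otimes>\<^bsub>?G\<^esub> b"
      using rels(2) by (simp add: c G.m_assoc)
    then show ?thesis by simp
  qed
  have F1: "F 1 = a" and F0: "F 0 = \<one>\<^bsub>?G\<^esub>" by (simp_all add: F_def)
  have Fadd: "F i \<otimes>\<^bsub>?G\<^esub> F j = F (i + j)" for i j by (simp add: F_def G.int_pow_mult)
  have Fa: "F i \<otimes>\<^bsub>?G\<^esub> a = F (i + 1)" for i using Fadd[of i 1] by (simp add: F1)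
  \<comment> \<open>The action of the inverse generators is read off from that of the
    generators.\<close>
  have div: "y = x \<otimes>\<^bsub>?G\<^esub> inv\<^bsub>?G\<^esub> s" if "y \<otimes>\<^bsub>?G\<^esub> s = x" "s \<in> carrier ?G" "y \<in> carrier ?G" for x y s
    using that by (auto simp: G.m_assoc)
  have Fia: "F i \<otimes>\<^bsub>?G\<^esub> inv\<^bsub>?G\<^esub> a = F (i - 1)" for i
    using div[OF Fa[of "i - 1"]] by simp
  have Ta: "T i \<otimes>\<^bsub>?G\<^esub> a = T (i - 1)" for i
  proof -
    have "T i \<otimes>\<^bsub>?G\<^esub> a = F (i - 1) \<otimes>\<^bsub>?G\<^esub> (a \<otimes>\<^bsub>?G\<^esub> (b \<otimes>\<^bsub>?G\<^esub> a))"
      using Fa[of "i - 1"] by (simp add: T_def flip: G.m_assoc)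
    then show ?thesis by (simp add: aba T_def)
  qed
  have Tia: "T i \<otimes>\<^bsub>?G\<^esub> inv\<^bsub>?G\<^esub> a = T (i + 1)" for i
    using div[OF Ta[of "i + 1"]] by simp
  have Fn: "F (int n) = b \<otimes>\<^bsub>?G\<^esub> b" using rels(1) by (simp add: F_def int_pow_int)
  have Tb: "T i \<otimes>\<^bsub>?G\<^esub> b = F (i + int n)" for i
    using Fadd[of i "int n"] by (simp add: Fn T_def G.m_assoc)
  have Tk: "T i \<otimes>\<^bsub>?G\<^esub> F (int k) = T (i - int k)" for i k
  proof (induction k)
    case (Suc k)
    have "F (int (Suc k)) = F (int k) \<otimes>\<^bsub>?G\<^esub> a" using Fa[of "int k"] by (simp add: add.commute)
    then have "T i \<otimes>\<^bsub>?G\<^esub> F (int (Suc k)) = T i \<otimes>\<^bsub>?G\<^esub> F (int k) \<otimes>\<^bsub>?G\<^esub> a" by (simp add: G.m_assoc)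
    then show ?case using Suc by (simp add: Ta algebra_simps)
  qed (simp add: F0)
  have F2n: "F (i + int n + int n) = F i" for i
  proof -
    \<comment> \<open>Both sides are the cube of \<open>b\<close>: multiply
      \<open>F (int n)\<close>, the square of \<open>b\<close>, by \<open>b\<close> on the right or
      on the left.\<close>
    have "T (int n) = T (- int n)"
      using Tk[of 0 n] Fn by (simp add: T_def F0 G.m_assoc)
    then have "F (int n) = F (- int n)" by (simp add: T_def)
    then have "F (i + int n) \<otimes>\<^bsub>?G\<^esub> F (int n) = F (i + int n) \<otimes>\<^bsub>?G\<^esub> F (- int n)" by simp
    then show ?thesis by (simp add: Fadd)
  qed
  have Fb: "F i \<otimes>\<^bsub>?G\<^esub> b = T i" for i by (simp add: T_def)
  have Tib: "T i \<otimes>\<^bsub>?G\<^esub> inv\<^bsub>?G\<^esub> b = F i" for i using div[OF Fb[of i]] by simp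
  have Fib: "F i \<otimes>\<^bsub>?G\<^esub> inv\<^bsub>?G\<^esub> b = T (i + int n)" for i
    by (rule div[symmetric]) (use F2n[of i] in \<open>simp_all add: Tb\<close>)
  have Fc': "F i \<otimes>\<^bsub>?G\<^esub> c = T (i + 1)" for i by (simp add: c Fa Fb flip: G.m_assoc)
  have Tc': "T i \<otimes>\<^bsub>?G\<^esub> c = F (i - 1 + int n)" for i by (simp add: c Ta Tb flip: G.m_assoc)
  have Tic: "T i \<otimes>\<^bsub>?G\<^esub> inv\<^bsub>?G\<^esub> c = F (i - 1)" for i using div[OF Fc'[of "i - 1"]] by simp
  have Fic: "F i \<otimes>\<^bsub>?G\<^esub> inv\<^bsub>?G\<^esub> c = T (i + 1 + int n)" for i
    by (rule div[symmetric]) (use F2n[of i] in \<open>simp_all add: Tc'\<close>)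
  have hFa: "h (F (i + 1)) = h (F i) \<otimes>\<^bsub>dic_model n\<^esub> (1, False)" for i
    using hg by (simp add: a_def flip: Fa)
  \<comment> \<open>The relations give only the periodicity. That there are no further coincidences
    is seen in the model, where index and sheet can be read off.\<close>
  have hF: "h (F i) = (i mod (2 * int n), False)" for i
  proof (induction i rule: int_induct[where k = 0])
    case base
    show ?case by (simp add: F0 dic_model_def)
  next
    case (step1 i)
    then show ?case by (simp add: hFa) (simp add: dic_model_def dic_model_mult_def mod_simps)
  next
    case (step2 i)
    have "h (F (i - 1)) \<otimes>\<^bsub>dic_model n\<^esub> (1, False) = (i mod (2 * int n), False)"
      using step2 hFa[of "i - 1"] by simp
    moreover have "h (F (i - 1)) \<in> carrier (dic_model n)" by simp
    ultimately show ?case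
      by (auto simp: dic_model_def dic_model_mult_def mod_simps split: prod.splits)
        (metis add_diff_cancel_right' mod_diff_left_eq mod_pos_pos_trivial)
  qed
  have hT: "h (T i) = (i mod (2 * int n), True)" for i
    by (simp add: T_def hF hg b_def) (simp add: dic_model_def dic_model_mult_def mod_simps)
  have Fper: "F (i + 2 * int n * q) = F i" for i q
  proof (induction q rule: int_induct[where k = 0])
    case (step1 q)
    then show ?case using F2n[of "i + 2 * int n * q"] by (simp add: algebra_simps)
  next
    case (step2 q)
    then show ?case using F2n[of "i + 2 * int n * (q - 1)"] by (simp add: algebra_simps)
  qed simp
  have F_iff: "F i = F j \<longleftrightarrow> 2 * int n dvd i - j" for i j
  proof
    show "2 * int n dvd i - j" if "F i = F j"
      using hF[of i] hF[of j] that mod_eq_dvd_iff by (metis prod.inject)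
    show "F i = F j" if dv: "2 * int n dvd i - j"
    proof -
      obtain q where "i - j = 2 * int n * q" using dv unfolding dvd_def by blast
      then have "i = j + 2 * int n * q" by simp
      then show ?thesis using Fper by simp
    qed
  qed
  have "dic_graph (rel_game.nbrs ?G {a, b, c}) (int n) F T"
  proof
    fix i j
    show "F i = F j \<longleftrightarrow> 2 * int n dvd i - j" by (rule F_iff)
    show "T i = T j \<longleftrightarrow> 2 * int n dvd i - j" by (simp add: T_def F_iff)
    show "F i \<noteq> T j" using hF[of i] hT[of j] by auto
    have nb: "G.nbrs u = {u \<otimes>\<^bsub>?G\<^esub> a, u \<otimes>\<^bsub>?G\<^esub> inv\<^bsub>?G\<^esub> a, u \<otimes>\<^bsub>?G\<^esub> b, u \<otimes>\<^bsub>?G\<^esub> inv\<^bsub>?G\<^esub> b,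
        u \<otimes>\<^bsub>?G\<^esub> c, u \<otimes>\<^bsub>?G\<^esub> inv\<^bsub>?G\<^esub> c}" for u
      by (auto simp: G.nbrs_def a_def b_def c_def)
    show "rel_game.nbrs ?G {a, b, c} (F i)
        = {F (i + 1), F (i - 1), T i, T (i + int n), T (i + 1), T (i + 1 + int n)}"
      using nb[of "F i"] by (simp add: Fa Fia Fb Fib Fc' Fic flip: a_def b_def c_def)
    show "rel_game.nbrs ?G {a, b, c} (T i)
        = {T (i + 1), T (i - 1), F i, F (i + int n), F (i - 1), F (i - 1 + int n)}"
      using nb[of "T i"] by (auto simp: Ta Tia Tb Tib Tc' Tic simp flip: a_def b_def c_def)
  qed
  then show ?thesis unfolding a_def b_def c_def F_def T_def .
qed

theorem theorem4p7:
  fixes n :: nat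
  assumes "odd n" and "n \<ge> 3"
  shows "rel_game.has_winning_strategy (Dic n) {dic_a n, dic_b n, dic_c n} Player2"
proof -
  have n: "n \<ge> 1" using assms by simp
  interpret rel_game "Dic n" "{dic_a n, dic_b n, dic_c n}" by (rule rel_game_Dic[OF n])
  interpret dic_graph nbrs "int n" "\<lambda>i. dic_a n [^]\<^bsub>Dic n\<^esub> i"
      "\<lambda>i. dic_a n [^]\<^bsub>Dic n\<^esub> i \<otimes>\<^bsub>Dic n\<^esub> dic_b n"
    by (rule dic_graph_Dic[OF n])
  show ?thesis
  proof (rule winning_strategy_from_invariant[where Q = "safe nbrs (int n) \<one>\<^bsub>Dic n\<^esub>"])
    show "safe nbrs (int n) \<one>\<^bsub>Dic n\<^esub> {\<one>\<^bsub>Dic n\<^esub>} \<one>\<^bsub>Dic n\<^esub> \<one>\<^bsub>Dic n\<^esub>" by (rule safe.start)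
  qed (rule safe_answered, use assms in auto)
qed

end
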